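(* For every integer $t\ge 4$, the tree $T(3,t,3)$ has $n=2t+15$ vertices (so $n$ is odd) and satisfies \[ \pi(T(3,t,3)) > 2\left(\frac32\right)^{(n-3)/2}. \] Consequently, for every odd integer $n\ge 23$ there is a tree $T$ on $n$ vertices with $\pi(T)>2\left(\frac32\right)^{(n-3)/2}$.
   Context: All graphs are finite and simple. For a graph $G$, $d(v)$ denotes the degree of a vertex $v$, and $L(G)=D(G)-A(G)$ is the Laplacian matrix, where $A(G)$ is the adjacency matrix and $D(G)$ is the diagonal matrix of degrees. The permanent of an $n\times n$ matrix $M=(m_{ij})$ is $\operatorname{per}(M)=\sum_{\sigma\in S_n}\prod_{i=1}^n m_{i,\sigma(i)}$. If $G$ has no isolated vertices, its Laplacian ratio is $\pi(G)=\operatorname{per}(L(G))/\prod_{v\in V(G)}d(v)$. For $m\ge 2$ and nonnegative integers $a_1,\ldots,a_m$, the tree $T(a_1,\ldots,a_m)$ is obtained from the path $x_1-x_2-\cdots-x_m$ by attaching, for each $i$, exactly $a_i$ pendant paths of length two to the vertex $x_i$; that is, each attached path has the form $x_i-y-z$ with new vertices $y,z$, where $y$ is adjacent exactly to $x_i$ and $z$, and $z$ is a leaf. *)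

theory Defs
  imports Complex_Main "HOL-Combinatorics.Permutations" "Graph_Theory.Graph_Theory"
begin

text \<open>
  A finite simple graph is a \<open>pair_graph\<close>: a finite vertex set with a symmetric, irreflexive set of
  ordered pairs, so that an undirected edge \<open>uv\<close> is represented by both \<open>(u, v)\<close> and \<open>(v, u)\<close>.
  Graph-theoretic notions of \<open>Graph_Theory\<close> are applied to it through \<open>with_proj\<close>.
\<close>

definition degree :: "'a pair_pre_digraph \<Rightarrow> 'a \<Rightarrow> nat" where
  "degree G v = card {w. (v, w) \<in> parcs G}"

definition adjacency_matrix :: "'a pair_pre_digraph \<Rightarrow> 'a \<Rightarrow> 'a \<Rightarrow> real" where
  "adjacency_matrix G u v = (if (u, v) \<in> parcs G then 1 else 0)"

definition degree_matrix :: "'a pair_pre_digraph \<Rightarrow> 'a \<Rightarrow> 'a \<Rightarrow> real" where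
  "degree_matrix G u v = (if u = v then real (degree G u) else 0)"

definition laplacian :: "'a pair_pre_digraph \<Rightarrow> 'a \<Rightarrow> 'a \<Rightarrow> real" where
  "laplacian G u v = degree_matrix G u v - adjacency_matrix G u v"

text \<open>The permanent of a matrix with rows and columns indexed by the finite set \<open>V\<close>.\<close>

definition permanent :: "'a set \<Rightarrow> ('a \<Rightarrow> 'a \<Rightarrow> real) \<Rightarrow> real" where
  "permanent V M = (\<Sum>\<sigma> | \<sigma> permutes V. \<Prod>v\<in>V. M v (\<sigma> v))"

text \<open>Meaningful for graphs without isolated vertices; otherwise the denominator is \<open>0\<close>.\<close>

definition laplacian_ratio :: "'a pair_pre_digraph \<Rightarrow> real" where
  "laplacian_ratio G =
     permanent (pverts G) (laplacian G) / (\<Prod>v\<in>pverts G. real (degree G v))"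

text \<open>
  The library's \<open>tree\<close> is a notion for digraphs, in which an edge traversed back and forth is a
  cycle. In a \<open>pair_graph\<close>, the directed cycles of length at least 3 are exactly the
  cycles of the undirected graph. The library's \<open>connected\<close> excludes the empty graph.
\<close>

definition is_tree :: "'a pair_pre_digraph \<Rightarrow> bool" where
  "is_tree G \<longleftrightarrow> pair_graph G \<and> Digraph_Component.connected (with_proj G) \<and>
     \<not> (\<exists>p. pre_digraph.cycle (with_proj G) p \<and> 3 \<le> length p)"

text \<open>
  The tree \<open>T(a\<^sub>1,\<dots>,a\<^sub>m)\<close> is \<open>pendant_tree [a\<^sub>1,\<dots>,a\<^sub>m]\<close>, with indices
  shifted to start at 0. \<open>Spine i\<close> is the path vertex \<open>x\<^sub>i\<close>, and the \<open>j\<close>-th pendant path at it is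
  \<open>Spine i - Mid i j - End i j\<close>.
\<close>

datatype pt_vertex = Spine nat | Mid nat nat | End nat nat

definition pendant_tree_verts :: "nat list \<Rightarrow> pt_vertex set" where
  "pendant_tree_verts as =
     {Spine i | i. i < length as} \<union>
     {Mid i j | i j. i < length as \<and> j < as ! i} \<union>
     {End i j | i j. i < length as \<and> j < as ! i}"

definition pendant_tree_edges :: "nat list \<Rightarrow> (pt_vertex \<times> pt_vertex) set" where
  "pendant_tree_edges as =
     {(Spine i, Spine (Suc i)) | i. Suc i < length as} \<union>
     {(Spine i, Mid i j) | i j. i < length as \<and> j < as ! i} \<union>
     {(Mid i j, End i j) | i j. i < length as \<and> j < as ! i}"

definition pendant_tree :: "nat list \<Rightarrow> pt_vertex pair_pre_digraph" where
  "pendant_tree as =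
     \<lparr> pverts = pendant_tree_verts as,
       parcs = pendant_tree_edges as \<union> (pendant_tree_edges as)\<inverse> \<rparr>"

end

theory Submission
  imports Defs
begin

text \<open>
  The Laplacian permanent of a tree satisfies a recursion at a leaf \<open>z\<close> with neighbour \<open>y\<close>:
  a permutation with a nonzero product either fixes \<open>z\<close> or swaps it with \<open>y\<close>, because the row
  and the column of \<open>z\<close> vanish elsewhere (\<open>permanent_leaf\<close>). Cutting off a pendant path
  \<open>x - y - z\<close> by two such steps shows that each path multiplies the permanent of the rest by 3,
  apart from the option that \<open>x\<close> is swapped with the middle vertex of one of its paths
  (\<open>permanent_pendant_paths\<close>). This reduces the permanent of \<open>T(3,t,3)\<close> to permanents over sets of
  spine vertices, and dividing by the degree product gives the exact value
  (\<open>laplacian_ratio_T3t3\<close>)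
  \<open>(3/2)^(t+6) \<cdot> (100t + 180) / (48(t + 2))\<close>.
  The last factor increases to \<open>25/12\<close> and equals 2 at \<open>t = 3\<close>, so the claimed bound
  holds from \<open>t = 4\<close> on, where \<open>n = 23\<close>. Every odd \<open>n \<ge> 23\<close> has the form \<open>2t + 15\<close> with
  \<open>t \<ge> 4\<close>.

  For the tree property it is convenient to describe the arcs by a parent function that decreases
  a height (\<open>rooted_by\<close>). Following parents leads to the root, which gives connectedness; a highest
  vertex of a cycle would have its parent as both neighbours, which excludes cycles of length at
  least 3. This description and the Laplacian ratio survive injective renaming of vertices,
  so the example can be moved to natural numbers.
\<close>

section \<open>Trees given by a parent function\<close>

definition rooted_by :: "'a pair_pre_digraph \<Rightarrow> 'a \<Rightarrow> ('a \<Rightarrow> 'a) \<Rightarrow> ('a \<Rightarrow> nat) \<Rightarrow> bool" where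
  "rooted_by G r par h \<longleftrightarrow>
     finite (pverts G) \<and> r \<in> pverts G \<and>
     (\<forall>v \<in> pverts G - {r}. par v \<in> pverts G \<and> h (par v) < h v) \<and>
     parcs G = (\<Union>v \<in> pverts G - {r}. {(v, par v), (par v, v)})"

lemma pair_graph_if_rooted_by:
  assumes "rooted_by G r par h"
  shows "pair_graph G"
proof -
  have V: "finite (pverts G)" "r \<in> pverts G"
    and par: "\<And>v. v \<in> pverts G - {r} \<Longrightarrow> par v \<in> pverts G \<and> h (par v) < h v"
    and arcs: "parcs G = (\<Union>v \<in> pverts G - {r}. {(v, par v), (par v, v)})"
    using assms by (simp_all add: rooted_by_def)
  have "finite (parcs G)"
    using V unfolding arcs by simp
  moreover have "symmetric (with_proj G)"
    unfolding symmetric_def with_proj_simps arcs by (rule symI) blast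
  moreover have "fst e \<in> pverts G \<and> snd e \<in> pverts G \<and> fst e \<noteq> snd e" if e: "e \<in> parcs G" for e
  proof -
    obtain v where v: "v \<in> pverts G - {r}" "e = (v, par v) \<or> e = (par v, v)"
      using e unfolding arcs by blast
    show ?thesis
      using v par[OF v(1)] by (elim disjE) auto
  qed
  ultimately show ?thesis
    using V by unfold_locales blast+
qed

lemma connected_if_rooted_by:
  assumes "rooted_by G r par h"
  shows "Digraph_Component.connected (with_proj G)"
proof -
  interpret pair_graph G
    using assms by (rule pair_graph_if_rooted_by)
  have root: "v \<rightarrow>\<^sup>*\<^bsub>with_proj G\<^esub> r" if "v \<in> pverts G" for v
    using that
  proof (induction "h v" arbitrary: v rule: less_induct)
    case less
    show ?case
    proof (cases "v = r")
      case False
      then have "par v \<in> pverts G" "h (par v) < h v" "(v, par v) \<in> parcs G"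
        using assms less.prems by (auto simp: rooted_by_def)
      then show ?thesis
        using less.hyps adj_reachable_trans by blast
    qed (use less.prems in auto)
  qed
  then have "u \<rightarrow>\<^sup>*\<^bsub>with_proj G\<^esub> v" if "u \<in> pverts G" "v \<in> pverts G" for u v
    using that by (meson reachable_trans symmetric_reachable')
  moreover have "pverts G \<noteq> {}"
    using assms by (auto simp: rooted_by_def)
  ultimately show ?thesis
    by (simp add: Digraph_Component.connected_def strongly_connected_def
        reachable_mk_symmetric_eq[OF sym_arcs])
qed

lemma pawalk_verts_conv_snd: "pcas u p v \<Longrightarrow> pawalk_verts u p = u # map snd p"
  by (induction p arbitrary: u) auto

lemma fst_nth_pcas: "pcas u p v \<Longrightarrow> k < length p \<Longrightarrow> fst (p ! k) = (u # map snd p) ! k"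
  by (induction p arbitrary: u k) (auto simp: nth_Cons split: nat.splits)

lemma last_pcas: "pcas u p v \<Longrightarrow> last (u # map snd p) = v"
  by (induction p arbitrary: u) auto

text \<open>
  The heads of the arcs of a cycle are used as its vertices, with indices modulo the length, so
  that neither the base point of the walk nor the repetition of its first vertex matters.
\<close>

lemma cycle_vertices:
  assumes "pre_digraph.cycle (with_proj G) p"
  defines "w \<equiv> \<lambda>k. snd (p ! k)"
  shows "inj_on w {..<length p}"
    and "k < length p \<Longrightarrow> (w k, w (Suc k mod length p)) \<in> parcs G"
proof -
  obtain u where p: "set p \<subseteq> parcs G" "pcas u p u" "distinct (tl (pawalk_verts u p))" "p \<noteq> []"
    using assms
    by (auto simp: pre_digraph.cycle_def pre_digraph.awalk_def cas_with_proj_eq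
        awalk_verts_with_proj_eq)
  then have "distinct (map snd p)"
    by (simp add: pawalk_verts_conv_snd)
  then show "inj_on w {..<length p}"
    by (auto simp: w_def inj_on_def distinct_conv_nth)
  show "(w k, w (Suc k mod length p)) \<in> parcs G" if k: "k < length p"
  proof (cases "Suc k = length p")
    case True
    then have "w k = u"
      using last_pcas[OF p(2)] p(4) True[symmetric] by (simp add: w_def last_map last_conv_nth)
    then show ?thesis
      using True p fst_nth_pcas[OF p(2), of 0] nth_mem[of 0 p]
      by (auto simp: w_def prod_eq_iff)
        (metis length_greater_0_conv list.set_sel(1) prod.collapse subsetD hd_conv_nth)
  next
    case False
    then have "Suc k < length p"
      using k by simp
    then have "fst (p ! Suc k) = w k" "p ! Suc k \<in> parcs G"
      using fst_nth_pcas[OF p(2)] p(1) by (auto simp: w_def)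
    then show ?thesis
      using \<open>Suc k < length p\<close> by (auto simp: w_def) (metis prod.collapse)
  qed
qed

lemma no_cycle_if_rooted_by:
  assumes G: "rooted_by G r par h" and p: "pre_digraph.cycle (with_proj G) p" "3 \<le> length p"
  shows False
proof -
  define w where "w = (\<lambda>k. snd (p ! k))"
  define n where "n = length p"
  have inj: "inj_on w {..<n}" and arc: "\<And>k. k < n \<Longrightarrow> (w k, w (Suc k mod n)) \<in> parcs G"
    using cycle_vertices[OF p(1)] by (auto simp: w_def n_def)
  have n: "3 \<le> n"
    using p by (simp add: n_def)
  \<comment> \<open>Each arc joins a child to its parent, and \<open>h\<close> rules out that \<open>y\<close> is the child.\<close>
  have lower: "y = par x" if "(x, y) \<in> parcs G \<or> (y, x) \<in> parcs G" "h y \<le> h x" for x y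
    using G that unfolding rooted_by_def by (auto dest: leD)
  have "finite (h ` w ` {..<n})" "h ` w ` {..<n} \<noteq> {}"
    using n by (auto simp: lessThan_empty_iff)
  then have "Max (h ` w ` {..<n}) \<in> h ` w ` {..<n}"
    by (rule Max_in)
  then obtain k where k: "k < n" "h (w k) = Max (h ` w ` {..<n})"
    by auto
  then have top: "h (w i) \<le> h (w k)" if "i < n" for i
    using that by simp
  \<comment> \<open>\<open>i\<close> and \<open>j\<close> are the cyclic predecessor and successor of \<open>k\<close>; they differ since \<open>n \<ge> 3\<close>.\<close>
  define i where "i = (if k = 0 then n - 1 else k - 1)"
  define j where "j = Suc k mod n"
  have ij: "i < n" "j < n" "Suc i mod n = k"
    using n k by (auto simp: i_def j_def)
  have "i \<noteq> j"
    using n k by (cases "Suc k = n") (auto simp: i_def j_def)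
  moreover have "w i = par (w k)" "w j = par (w k)"
    using arc[OF ij(1)] arc[OF k(1)] top ij by (auto intro!: lower simp: j_def)
  ultimately show False
    using ij(1,2) inj_onD[OF inj, of i j] by simp
qed

lemma is_tree_if_rooted_by: "rooted_by G r par h \<Longrightarrow> is_tree G"
  unfolding is_tree_def
  using pair_graph_if_rooted_by[of G r par h] connected_if_rooted_by[of G r par h]
    no_cycle_if_rooted_by[of G r par h]
  by auto

section \<open>Relabelling vertices\<close>

definition relabel :: "('a \<Rightarrow> 'b) \<Rightarrow> 'a pair_pre_digraph \<Rightarrow> 'b pair_pre_digraph" where
  "relabel f G = \<lparr>pverts = f ` pverts G, parcs = map_prod f f ` parcs G\<rparr>"

lemma rooted_by_relabel:
  assumes G: "rooted_by G r par h" and f: "inj_on f (pverts G)"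
  shows "rooted_by (relabel f G) (f r) (f \<circ> par \<circ> inv_into (pverts G) f) (h \<circ> inv_into (pverts G) f)"
proof -
  let ?g = "inv_into (pverts G) f"
  have [simp]: "?g (f v) = v" if "v \<in> pverts G" for v
    using f that by simp
  have r: "r \<in> pverts G"
    using G by (simp add: rooted_by_def)
  have ne: "f ` pverts G - {f r} = f ` (pverts G - {r})"
    using f r by (auto dest: inj_onD)
  show ?thesis
    using G unfolding rooted_by_def relabel_def
    by (simp add: ne image_UN)
qed

lemma permanent_reindex:
  assumes f: "inj_on f V" and M: "\<And>u v. u \<in> V \<Longrightarrow> v \<in> V \<Longrightarrow> M' (f u) (f v) = M u v"
  shows "permanent (f ` V) M' = permanent V M"
proof -
  let ?c = "\<lambda>\<sigma> x. if x \<in> f ` V then f (\<sigma> (inv_into V f x)) else x"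
  have "permanent (f ` V) M' = (\<Sum>\<sigma> | \<sigma> permutes V. \<Prod>x\<in>f ` V. M' x (?c \<sigma> x))"
    unfolding permanent_def
    by (rule sum.reindex_bij_betw[symmetric], rule bij_betw_permutations)
      (use f in \<open>auto simp: bij_betw_def\<close>)
  also have "\<dots> = permanent V M"
    unfolding permanent_def
    using f by (intro sum.cong refl) (auto simp: prod.reindex M permutes_in_image intro!: prod.cong)
  finally show ?thesis .
qed

lemma laplacian_ratio_relabel:
  assumes G: "pair_graph G" and f: "inj_on f (pverts G)"
  shows "laplacian_ratio (relabel f G) = laplacian_ratio G"
proof -
  interpret pair_graph G by fact
  have arc: "(f u, f v) \<in> parcs (relabel f G) \<longleftrightarrow> (u, v) \<in> parcs G"
    if "u \<in> pverts G" "v \<in> pverts G" for u v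
  proof
    assume "(f u, f v) \<in> parcs (relabel f G)"
    then obtain x y where xy: "(x, y) \<in> parcs G" "f u = f x" "f v = f y"
      by (auto simp: relabel_def)
    then have "u = x" "v = y"
      using that in_arcsD1 in_arcsD2 inj_onD[OF f] by blast+
    then show "(u, v) \<in> parcs G"
      using xy by simp
  next
    assume "(u, v) \<in> parcs G"
    then have "map_prod f f (u, v) \<in> map_prod f f ` parcs G"
      by (rule imageI)
    then show "(f u, f v) \<in> parcs (relabel f G)"
      by (simp add: relabel_def)
  qed
  have deg: "degree (relabel f G) (f u) = degree G u" if u: "u \<in> pverts G" for u
  proof -
    have "{w. (f u, w) \<in> parcs (relabel f G)} = f ` {w. (u, w) \<in> parcs G}"
    proof
      show "f ` {w. (u, w) \<in> parcs G} \<subseteq> {w. (f u, w) \<in> parcs (relabel f G)}"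
        using arc u in_arcsD2 by blast
      show "{w. (f u, w) \<in> parcs (relabel f G)} \<subseteq> f ` {w. (u, w) \<in> parcs G}"
      proof clarify
        fix w assume w: "(f u, w) \<in> parcs (relabel f G)"
        then obtain v where "v \<in> pverts G" "w = f v"
          using in_arcsD2 by (auto simp: relabel_def)
        then show "w \<in> f ` {w. (u, w) \<in> parcs G}"
          using arc u w by blast
      qed
    qed
    moreover have "inj_on f {w. (u, w) \<in> parcs G}"
      by (rule inj_on_subset[OF f]) (use in_arcsD2 in blast)
    ultimately show ?thesis
      by (simp add: degree_def card_image)
  qed
  have "laplacian (relabel f G) (f u) (f v) = laplacian G u v"
    if "u \<in> pverts G" "v \<in> pverts G" for u v
    using that inj_on_eq_iff[OF f]
    by (simp add: laplacian_def degree_matrix_def adjacency_matrix_def arc deg)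
  then have "permanent (f ` pverts G) (laplacian (relabel f G)) = permanent (pverts G) (laplacian G)"
    using f by (intro permanent_reindex)
  moreover have "pverts (relabel f G) = f ` pverts G"
    by (simp add: relabel_def)
  ultimately show ?thesis
    using f by (simp add: laplacian_ratio_def prod.reindex deg)
qed

lemma tree_on_nat:
  fixes G :: "'a pair_pre_digraph"
  assumes "rooted_by G r par h"
  shows "\<exists>T :: nat pair_pre_digraph. is_tree T \<and> card (pverts T) = card (pverts G) \<and>
           laplacian_ratio T = laplacian_ratio G"
proof -
  have "finite (pverts G)"
    using assms by (simp add: rooted_by_def)
  then obtain f :: "'a \<Rightarrow> nat" where "bij_betw f (pverts G) {0..<card (pverts G)}"
    using ex_bij_betw_finite_nat by metis
  then have f: "inj_on f (pverts G)"
    by (rule bij_betw_imp_inj_on)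
  show ?thesis
  proof (intro exI conjI)
    show "is_tree (relabel f G)"
      using rooted_by_relabel[OF assms f] by (rule is_tree_if_rooted_by)
    show "card (pverts (relabel f G)) = card (pverts G)"
      using f by (simp add: relabel_def card_image)
    show "laplacian_ratio (relabel f G) = laplacian_ratio G"
      using pair_graph_if_rooted_by[OF assms] f by (rule laplacian_ratio_relabel)
  qed
qed

section \<open>Expanding permanents at leaves\<close>

text \<open>
  Split the permutations by the image of \<open>z\<close>. A permutation \<open>transpose z b \<circ> q\<close> with \<open>q\<close> on \<open>W\<close>
  contributes only for \<open>b = z\<close> or \<open>b = y\<close>, and for \<open>b = y\<close> the element that it sends to \<open>z\<close> is
  the \<open>q\<close>-preimage of \<open>y\<close>, which must again be \<open>y\<close>. Taking \<open>y \<notin> W\<close> covers a vertex without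
  neighbours in \<open>W\<close>.
\<close>

lemma permanent_leaf:
  fixes M :: "'a \<Rightarrow> 'a \<Rightarrow> real"
  assumes W: "finite W" "z \<notin> W"
    and zero: "\<And>w. w \<in> W \<Longrightarrow> w \<noteq> y \<Longrightarrow> M z w = 0 \<and> M w z = 0"
  shows "permanent (insert z W) M =
    M z z * permanent W M + (if y \<in> W then M z y * M y z * permanent (W - {y}) M else 0)"
proof -
  let ?t = "\<lambda>b. \<Sum>q | q permutes W. \<Prod>v\<in>insert z W. M v ((transpose z b \<circ> q) v)"
  have t: "?t b = M z b * (\<Sum>q | q permutes W. \<Prod>v\<in>W. M v (transpose z b (q v)))" for b
    unfolding sum_distrib_left
    by (rule sum.cong) (use W in \<open>auto simp: permutes_not_in\<close>)
  have tz: "?t z = M z z * permanent W M"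
    unfolding t by (simp add: permanent_def)
  have ty: "?t y = M z y * M y z * permanent (W - {y}) M" if y: "y \<in> W"
  proof -
    have "(\<Sum>q | q permutes W. \<Prod>v\<in>W. M v (transpose z y (q v))) =
      (\<Sum>q | q permutes (W - {y}). \<Prod>v\<in>W. M v (transpose z y (q v)))"
      \<comment> \<open>If \<open>q\<close> moves \<open>y\<close>, the preimage of \<open>y\<close> picks a vanishing entry in the column of \<open>z\<close>.\<close>
    proof (rule sum.mono_neutral_right)
      show "finite {q. q permutes W}"
        using W by (simp add: finite_permutations)
      show "{q. q permutes (W - {y})} \<subseteq> {q. q permutes W}"
        by (auto intro: permutes_subset)
      show "\<forall>q \<in> {q. q permutes W} - {q. q permutes (W - {y})}.
        (\<Prod>v\<in>W. M v (transpose z y (q v))) = 0"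
      proof
        fix q assume q: "q \<in> {q. q permutes W} - {q. q permutes (W - {y})}"
        then have "q y \<noteq> y"
          using permutes_superset[of q W "W - {y}"] by auto
        define v where "v = inv q y"
        have "q v = y" "v \<in> W" "v \<noteq> y"
          using q y \<open>q y \<noteq> y\<close> unfolding v_def
          by (auto simp: permutes_inverses permutes_inv permutes_in_image)
            (metis permutes_inverses(1))
        then have "M v (transpose z y (q v)) = 0"
          using zero by simp
        then show "(\<Prod>v\<in>W. M v (transpose z y (q v))) = 0"
          using W \<open>v \<in> W\<close> by (auto intro: prod_zero)
      qed
    qed
    also have "\<dots> = (\<Sum>q | q permutes (W - {y}). M y z * (\<Prod>v\<in>W - {y}. M v (q v)))"
    proof (rule sum.cong[OF refl])
      fix q assume "q \<in> {q. q permutes (W - {y})}"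
      then have q: "q permutes (W - {y})" by simp
      have "q v \<noteq> z" "q v \<noteq> y" if "v \<in> W - {y}" for v
        using that W permutes_in_image[OF q] by (metis DiffD1 DiffD2 singletonI)+
      then have "(\<Prod>v\<in>W - {y}. M v (transpose z y (q v))) = (\<Prod>v\<in>W - {y}. M v (q v))"
        by (intro prod.cong) auto
      moreover have "q y = y"
        using q by (simp add: permutes_not_in)
      ultimately show "(\<Prod>v\<in>W. M v (transpose z y (q v))) = M y z * (\<Prod>v\<in>W - {y}. M v (q v))"
        using W y by (simp add: prod.remove)
    qed
    finally show ?thesis
      unfolding t by (simp add: permanent_def sum_distrib_left mult.assoc)
  qed
  have t0: "?t b = 0" if "b \<in> W" "b \<noteq> y" for b
    unfolding t using zero that by simp
  have "permanent (insert z W) M = ?t z + (\<Sum>b\<in>W. ?t b)"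
    unfolding permanent_def sum_over_permutations_insert[OF W]
    using W by simp
  also have "(\<Sum>b\<in>W. ?t b) = (if y \<in> W then ?t y else 0)"
  proof (cases "y \<in> W")
    case True
    then have "(\<Sum>b\<in>W. ?t b) = ?t y + (\<Sum>b\<in>W - {y}. ?t b)"
      using W by (simp only: sum.remove)
    also have "(\<Sum>b\<in>W - {y}. ?t b) = 0"
      by (rule sum.neutral) (use t0 in blast)
    finally show ?thesis
      using True by simp
  next
    case False
    have "(\<Sum>b\<in>W. ?t b) = 0"
      by (rule sum.neutral) (use False t0 in blast)
    then show ?thesis
      using False by simp
  qed
  finally show ?thesis
    using tz ty by simp
qed

lemma permanent_empty: "permanent {} M = 1"
  by (simp add: permanent_def)

section \<open>Trees with pendant paths\<close>

definition pendant_paths :: "nat \<Rightarrow> nat \<Rightarrow> pt_vertex set" where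
  "pendant_paths i k = Mid i ` {..<k} \<union> End i ` {..<k}"

lemma pendant_paths_0 [simp]: "pendant_paths i 0 = {}"
  by (simp add: pendant_paths_def)

lemma pendant_paths_Suc:
  "pendant_paths i (Suc k) = insert (End i k) (insert (Mid i k) (pendant_paths i k))"
  by (auto simp: pendant_paths_def lessThan_Suc)

lemma finite_pendant_paths [simp]: "finite (pendant_paths i k)"
  by (simp add: pendant_paths_def)

lemma mem_pendant_paths [simp]:
  "Spine a \<notin> pendant_paths i k"
  "Mid a b \<in> pendant_paths i k \<longleftrightarrow> a = i \<and> b < k"
  "End a b \<in> pendant_paths i k \<longleftrightarrow> a = i \<and> b < k"
  by (auto simp: pendant_paths_def)

lemma card_pendant_paths: "card (pendant_paths i k) = 2 * k"
  by (induction k) (auto simp: pendant_paths_Suc)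

lemma arc_pendant_tree [simp]:
  "(Spine i, Spine j) \<in> parcs (pendant_tree as) \<longleftrightarrow>
     i < length as \<and> j < length as \<and> (j = Suc i \<or> i = Suc j)"
  "(Spine i, Mid i' j) \<in> parcs (pendant_tree as) \<longleftrightarrow> i' = i \<and> i < length as \<and> j < as ! i"
  "(Mid i' j, Spine i) \<in> parcs (pendant_tree as) \<longleftrightarrow> i' = i \<and> i < length as \<and> j < as ! i"
  "(Mid i j, End i' j') \<in> parcs (pendant_tree as) \<longleftrightarrow>
     i' = i \<and> j' = j \<and> i < length as \<and> j < as ! i"
  "(End i' j', Mid i j) \<in> parcs (pendant_tree as) \<longleftrightarrow>
     i' = i \<and> j' = j \<and> i < length as \<and> j < as ! i"
  "(Mid i j, Mid i' j') \<notin> parcs (pendant_tree as)"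
  "(End i j, End i' j') \<notin> parcs (pendant_tree as)"
  "(Spine i, End i' j') \<notin> parcs (pendant_tree as)"
  "(End i' j', Spine i) \<notin> parcs (pendant_tree as)"
  by (auto simp: pendant_tree_def pendant_tree_edges_def)

lemma rooted_by_pendant_tree:
  assumes "as \<noteq> []"
  shows "rooted_by (pendant_tree as) (Spine 0)
    (\<lambda>v. case v of Spine i \<Rightarrow> Spine (i - 1) | Mid i j \<Rightarrow> Spine i | End i j \<Rightarrow> Mid i j)
    (\<lambda>v. case v of Spine i \<Rightarrow> i | Mid i j \<Rightarrow> i + 1 | End i j \<Rightarrow> i + 2)"
    (is "rooted_by ?G ?r ?par ?h")
proof -
  have V: "pverts ?G = Spine ` {..<length as} \<union> (\<Union>i<length as. pendant_paths i (as ! i))"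
    by (auto simp: pendant_tree_def pendant_tree_verts_def pendant_paths_def)
  have [simp]:
    "Spine i \<in> pverts ?G \<longleftrightarrow> i < length as"
    "Mid i j \<in> pverts ?G \<longleftrightarrow> i < length as \<and> j < as ! i"
    "End i j \<in> pverts ?G \<longleftrightarrow> i < length as \<and> j < as ! i" for i j
    by (auto simp: V)
  have "finite (pverts ?G)"
    by (simp add: V)
  moreover have "?r \<in> pverts ?G"
    using assms by simp
  moreover have "?par v \<in> pverts ?G \<and> ?h (?par v) < ?h v" if "v \<in> pverts ?G - {?r}" for v
    using that by (cases v) auto
  moreover have "parcs ?G = (\<Union>v \<in> pverts ?G - {?r}. {(v, ?par v), (?par v, v)})"
  proof (rule set_eqI, clarify)
    fix u v
    have "(u, v) \<in> parcs ?G \<longleftrightarrow>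
      u \<in> pverts ?G - {?r} \<and> v = ?par u \<or> v \<in> pverts ?G - {?r} \<and> u = ?par v"
      by (cases u; cases v) auto
    then show "(u, v) \<in> parcs ?G \<longleftrightarrow>
      (u, v) \<in> (\<Union>v \<in> pverts ?G - {?r}. {(v, ?par v), (?par v, v)})"
      by blast
  qed
  ultimately show ?thesis
    unfolding rooted_by_def by blast
qed

lemma degree_pendant_tree:
  assumes "i < length as"
  shows "degree (pendant_tree as) (Spine i) =
      as ! i + (if i = 0 then 0 else 1) + (if Suc i < length as then 1 else 0)"
    and "j < as ! i \<Longrightarrow> degree (pendant_tree as) (Mid i j) = 2"
    and "j < as ! i \<Longrightarrow> degree (pendant_tree as) (End i j) = 1"
proof -
  have "{w. (Spine i, w) \<in> parcs (pendant_tree as)} = Mid i ` {..<as ! i} \<union>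
    (if i = 0 then {} else {Spine (i - 1)}) \<union> (if Suc i < length as then {Spine (Suc i)} else {})"
    (is "?N = ?R")
  proof (rule set_eqI)
    show "w \<in> ?N \<longleftrightarrow> w \<in> ?R" for w
      using assms by (cases w) auto
  qed
  moreover have "card \<dots> =
      as ! i + (if i = 0 then 0 else 1) + (if Suc i < length as then 1 else 0)"
    by (auto simp: card_Un_disjoint card_image inj_on_def card_insert_if)
  ultimately show "degree (pendant_tree as) (Spine i) =
      as ! i + (if i = 0 then 0 else 1) + (if Suc i < length as then 1 else 0)"
    unfolding degree_def by simp
  assume j: "j < as ! i"
  have "{w. (Mid i j, w) \<in> parcs (pendant_tree as)} = {Spine i, End i j}" (is "?N = ?R")
  proof (rule set_eqI)
    show "w \<in> ?N \<longleftrightarrow> w \<in> ?R" for w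
      using assms j by (cases w) auto
  qed
  then show "degree (pendant_tree as) (Mid i j) = 2"
    by (simp add: degree_def)
  have "{w. (End i j, w) \<in> parcs (pendant_tree as)} = {Mid i j}" (is "?N = ?R")
  proof (rule set_eqI)
    show "w \<in> ?N \<longleftrightarrow> w \<in> ?R" for w
      using assms j by (cases w) auto
  qed
  then show "degree (pendant_tree as) (End i j) = 1"
    by (simp add: degree_def)
qed

lemma laplacian_simps:
  "u \<noteq> v \<Longrightarrow> laplacian G u v = (if (u, v) \<in> parcs G then - 1 else 0)"
  "(v, v) \<notin> parcs G \<Longrightarrow> laplacian G v v = degree G v"
  by (auto simp: laplacian_def degree_matrix_def adjacency_matrix_def)

lemma prod_degree_pendant_paths:
  assumes "i < length as" "k \<le> as ! i"
  shows "(\<Prod>v\<in>pendant_paths i k. real (degree (pendant_tree as) v)) = 2 ^ k"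
  using assms(2)
  by (induction k) (use assms(1) in \<open>auto simp: pendant_paths_Suc degree_pendant_tree\<close>)

text \<open>
  A path that does not interact with \<open>W\<close> contributes the permanent of the block of its two
  vertices, \<open>2 \<cdot> 1 + (-1)(-1) = 3\<close>. If instead \<open>Spine i\<close> is swapped with one of the \<open>k\<close> middle
  vertices, the end of that path is fixed with entry 1 and the other \<open>k - 1\<close> paths
  contribute 3 each.
  The set \<open>W\<close> need not contain \<open>Spine i\<close>: the induction step also needs the
  statement for \<open>W - {Spine i}\<close>.
\<close>

lemma permanent_pendant_paths:
  assumes i: "i < length as" "k \<le> as ! i"
    and W: "finite W" "\<And>j. Mid i j \<notin> W" "\<And>j. End i j \<notin> W"
  defines "L \<equiv> laplacian (pendant_tree as)"
  shows "permanent (W \<union> pendant_paths i k) L = 3 ^ k * permanent W L +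
    (if Spine i \<in> W then real k * 3 ^ (k - 1) * permanent (W - {Spine i}) L else 0)"
  using i(2) W
proof (induction k arbitrary: W)
  case (Suc k)
  note IH = Suc.IH[OF Suc_leD[OF Suc.prems(1)]]
  let ?U = "W \<union> pendant_paths i k"
  have adj_Mid: "L (Mid i k) v = 0 \<and> L v (Mid i k) = 0" if "v \<in> ?U" "v \<noteq> Spine i" for v
  proof -
    have "v \<noteq> Mid i k"
      using that(1) Suc.prems by auto
    then show ?thesis
      using that Suc.prems by (cases v) (auto simp: L_def laplacian_simps)
  qed
  have adj_End: "L (End i k) v = 0 \<and> L v (End i k) = 0" if "v \<in> insert (Mid i k) ?U" "v \<noteq> Mid i k" for v
  proof -
    have "v \<noteq> End i k"
      using that(1) Suc.prems by auto
    then show ?thesis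
      using that Suc.prems by (cases v) (auto simp: L_def laplacian_simps)
  qed
  have L: "L (Mid i k) (Mid i k) = 2" "L (End i k) (End i k) = 1"
      "L (Mid i k) (End i k) = - 1" "L (End i k) (Mid i k) = - 1"
      "L (Mid i k) (Spine i) = - 1" "L (Spine i) (Mid i k) = - 1"
    using i Suc.prems by (auto simp: L_def laplacian_simps degree_pendant_tree)
  have fresh: "Mid i k \<notin> ?U" "End i k \<notin> insert (Mid i k) ?U"
    using Suc.prems by auto
  have "permanent (W \<union> pendant_paths i (Suc k)) L =
      permanent (insert (End i k) (insert (Mid i k) ?U)) L"
    by (simp add: pendant_paths_Suc)
  also have "\<dots> = permanent (insert (Mid i k) ?U) L + permanent ?U L"
    using permanent_leaf[of "insert (Mid i k) ?U" "End i k" "Mid i k" L] adj_End fresh Suc.prems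
    by (simp add: L)
  also have "permanent (insert (Mid i k) ?U) L = 2 * permanent ?U L +
      (if Spine i \<in> W then permanent (?U - {Spine i}) L else 0)"
    using permanent_leaf[of ?U "Mid i k" "Spine i" L] adj_Mid fresh Suc.prems by (simp add: L)
  also have "?U - {Spine i} = (W - {Spine i}) \<union> pendant_paths i k"
    by auto
  also have "permanent \<dots> L = 3 ^ k * permanent (W - {Spine i}) L"
    using IH[of "W - {Spine i}"] Suc.prems by simp
  also have "permanent ?U L = 3 ^ k * permanent W L +
    (if Spine i \<in> W then real k * 3 ^ (k - 1) * permanent (W - {Spine i}) L else 0)"
    using IH[of W] Suc.prems by simp
  finally show ?case
    by (cases k) (auto simp: algebra_simps)
qed simp

section \<open>The trees T(3,t,3)\<close>

lemma pverts_T3t3: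
  "pverts (pendant_tree [3, t, 3]) =
     {Spine 0, Spine 1, Spine 2} \<union> pendant_paths 0 3 \<union> pendant_paths 1 t \<union> pendant_paths 2 3"
proof (rule set_eqI)
  show "v \<in> pverts (pendant_tree [3, t, 3]) \<longleftrightarrow> v \<in> {Spine 0, Spine 1, Spine 2} \<union>
    pendant_paths 0 3 \<union> pendant_paths 1 t \<union> pendant_paths 2 3" for v
    by (cases v) (auto simp: pendant_tree_def pendant_tree_verts_def less_Suc_eq)
qed

lemma disjoint_T3t3:
  "{Spine 0, Spine 1, Spine 2} \<inter> pendant_paths 0 3 = {}"
  "({Spine 0, Spine 1, Spine 2} \<union> pendant_paths 0 3) \<inter> pendant_paths 1 t = {}"
  "({Spine 0, Spine 1, Spine 2} \<union> pendant_paths 0 3 \<union> pendant_paths 1 t) \<inter> pendant_paths 2 3 = {}"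
  by (auto simp: pendant_paths_def)

lemma card_T3t3: "card (pverts (pendant_tree [3, t, 3])) = 2 * t + 15"
proof -
  have "card ({Spine 0, Spine 1, Spine 2} \<union> pendant_paths 0 3 \<union> pendant_paths 1 t \<union> pendant_paths 2 3)
      = 3 + 2 * 3 + 2 * t + 2 * 3"
    by (simp only: card_Un_disjoint disjoint_T3t3 finite.intros finite_Un finite_pendant_paths
        card_pendant_paths) simp
  then show ?thesis
    by (simp add: pverts_T3t3)
qed

lemma prod_degree_T3t3:
  "(\<Prod>v\<in>pverts (pendant_tree [3, t, 3]). real (degree (pendant_tree [3, t, 3]) v)) =
     16 * (real t + 2) * 2 ^ (t + 6)"
proof -
  let ?T = "pendant_tree [3, t, 3]"
  let ?d = "\<lambda>v. real (degree ?T v)"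
  have "prod ?d (pverts ?T) = prod ?d {Spine 0, Spine 1, Spine 2} *
      prod ?d (pendant_paths 0 3) * prod ?d (pendant_paths 1 t) * prod ?d (pendant_paths 2 3)"
    unfolding pverts_T3t3
    by (simp only: prod.union_disjoint disjoint_T3t3 finite.intros finite_Un finite_pendant_paths)
  also have "prod ?d {Spine 0, Spine 1, Spine 2} = 16 * (real t + 2)"
    by (simp add: degree_pendant_tree)
  also have "prod ?d (pendant_paths 0 3) = 2 ^ 3"
    by (rule prod_degree_pendant_paths) simp_all
  also have "prod ?d (pendant_paths 1 t) = 2 ^ t"
    by (rule prod_degree_pendant_paths) simp_all
  also have "prod ?d (pendant_paths 2 3) = 2 ^ 3"
    by (rule prod_degree_pendant_paths) simp_all
  finally show ?thesis
    by (simp add: power_add)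
qed

lemma permanent_spine_T3t3:
  fixes t :: nat
  defines "L \<equiv> laplacian (pendant_tree [3, t, 3])"
  shows "permanent {Spine 0} L = 4" "permanent {Spine 1} L = real t + 2"
    "permanent {Spine 2} L = 4"
    "permanent {Spine 0, Spine 1} L = 4 * real t + 9"
    "permanent {Spine 1, Spine 2} L = 4 * real t + 9"
    "permanent {Spine 0, Spine 2} L = 16"
    "permanent {Spine 0, Spine 1, Spine 2} L = 16 * real t + 40"
proof -
  have L: "L (Spine 0) (Spine 0) = 4" "L (Spine 1) (Spine 1) = real t + 2"
    "L (Spine 2) (Spine 2) = 4" "L (Spine 0) (Spine 1) = - 1" "L (Spine 1) (Spine 0) = - 1"
    "L (Spine 1) (Spine 2) = - 1" "L (Spine 2) (Spine 1) = - 1"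
    "L (Spine 0) (Spine 2) = 0" "L (Spine 2) (Spine 0) = 0"
    by (simp_all add: L_def laplacian_simps degree_pendant_tree)
  have single: "permanent {z} L = L z z" for z
    using permanent_leaf[of "{}" z z L] by (simp add: permanent_empty)
  show "permanent {Spine 0} L = 4" and 1: "permanent {Spine 1} L = real t + 2"
    and 2: "permanent {Spine 2} L = 4"
    by (simp_all only: single L)
  show "permanent {Spine 0, Spine 1} L = 4 * real t + 9"
    using permanent_leaf[of "{Spine 1}" "Spine 0" "Spine 1" L] 1
    by (simp add: L L[unfolded One_nat_def] permanent_empty algebra_simps)
  show 12: "permanent {Spine 1, Spine 2} L = 4 * real t + 9"
    using permanent_leaf[of "{Spine 2}" "Spine 1" "Spine 2" L] 2
    by (simp add: L L[unfolded One_nat_def] permanent_empty algebra_simps)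
  show "permanent {Spine 0, Spine 2} L = 16"
    using permanent_leaf[of "{Spine 2}" "Spine 0" "Spine 1" L] 2
    by (simp add: L)
  have "{Spine 1, Spine 2} - {Spine 1} = {Spine 2}"
    by auto
  then show "permanent {Spine 0, Spine 1, Spine 2} L = 16 * real t + 40"
    using permanent_leaf[of "{Spine 1, Spine 2}" "Spine 0" "Spine 1" L] 2 12
    by (simp add: L L[unfolded One_nat_def] algebra_simps)
qed

lemma permanent_T3t3:
  "permanent (pverts (pendant_tree [3, t, 3])) (laplacian (pendant_tree [3, t, 3])) =
     3 ^ (t + 6) * (100 * real t + 180) / 3"
proof -
  define L where "L = laplacian (pendant_tree [3, t, 3])"
  \<comment> \<open>Strip the paths at spine vertices 2, 1, 0 in turn. The set \<open>S\<close> records which spine vertices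
    have not yet been swapped with a middle vertex.\<close>
  let ?P0 = "pendant_paths 0 3" and ?P1 = "pendant_paths 1 t" and ?P2 = "pendant_paths 2 3"
  have at0: "permanent (S \<union> ?P0) L =
      27 * permanent S L + (if Spine 0 \<in> S then 27 * permanent (S - {Spine 0}) L else 0)"
    if S: "finite S" "S \<subseteq> range Spine" for S
  proof -
    have "Mid 0 j \<notin> S" "End 0 j \<notin> S" for j
      using S(2) by auto
    then show ?thesis
      using permanent_pendant_paths[of 0 "[3, t, 3]" 3 S] S(1) by (simp add: L_def)
  qed
  have at1: "permanent (S \<union> ?P0 \<union> ?P1) L = 3 ^ t * permanent (S \<union> ?P0) L +
      (if Spine 1 \<in> S then 3 ^ t * (real t / 3) * permanent (S - {Spine 1} \<union> ?P0) L else 0)"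
    if S: "finite S" "S \<subseteq> range Spine" for S
  proof -
    have "Mid 1 j \<notin> S \<union> ?P0" "End 1 j \<notin> S \<union> ?P0" for j
      using S(2) by auto
    moreover have "(S \<union> ?P0) - {Spine 1} = S - {Spine 1} \<union> ?P0"
      by auto
    ultimately have "permanent (S \<union> ?P0 \<union> ?P1) L = 3 ^ t * permanent (S \<union> ?P0) L +
      (if Spine 1 \<in> S then real t * 3 ^ (t - 1) * permanent (S - {Spine 1} \<union> ?P0) L else 0)"
      using permanent_pendant_paths[of 1 "[3, t, 3]" t "S \<union> ?P0"] S(1) by (simp add: L_def)
    \<comment> \<open>Removes the truncated subtraction; at \<open>t = 0\<close> both sides vanish.\<close>
    moreover have "real t * 3 ^ (t - 1) = 3 ^ t * (real t / 3)"
      by (cases t) auto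
    ultimately show ?thesis
      by (simp only:)
  qed
  have at2: "permanent (S \<union> ?P0 \<union> ?P1 \<union> ?P2) L = 27 * permanent (S \<union> ?P0 \<union> ?P1) L +
      (if Spine 2 \<in> S then 27 * permanent (S - {Spine 2} \<union> ?P0 \<union> ?P1) L else 0)"
    if S: "finite S" "S \<subseteq> range Spine" for S
  proof -
    have "Mid 2 j \<notin> S \<union> ?P0 \<union> ?P1" "End 2 j \<notin> S \<union> ?P0 \<union> ?P1" for j
      using S(2) by auto
    moreover have "(S \<union> ?P0 \<union> ?P1) - {Spine 2} = S - {Spine 2} \<union> ?P0 \<union> ?P1"
      by auto
    ultimately show ?thesis
      using permanent_pendant_paths[of 2 "[3, t, 3]" 3 "S \<union> ?P0 \<union> ?P1"] S(1) by (simp add: L_def)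
  qed
  let ?S = "{Spine 0, Spine 1, Spine 2}"
  have del: "?S - {Spine 2} = {Spine 0, Spine 1}" "?S - {Spine 1} = {Spine 0, Spine 2}"
    "?S - {Spine 0} = {Spine 1, Spine 2}" "{Spine 0, Spine 1} - {Spine 1} = {Spine 0}"
    "{Spine 0, Spine 1} - {Spine 0} = {Spine 1}" "{Spine 0, Spine 2} - {Spine 0} = {Spine 2}"
    by auto
  note spine = permanent_spine_T3t3[of t, folded L_def]
  have p012: "permanent (?S \<union> ?P0) L = 27 * (16 * real t + 40) + 27 * (4 * real t + 9)"
    using at0[of ?S] unfolding del spine by simp
  have p01: "permanent ({Spine 0, Spine 1} \<union> ?P0) L = 27 * (4 * real t + 9) + 27 * (real t + 2)"
    using at0[of "{Spine 0, Spine 1}"] unfolding del spine by simp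
  have p02: "permanent ({Spine 0, Spine 2} \<union> ?P0) L = 27 * 16 + 27 * 4"
    using at0[of "{Spine 0, Spine 2}"] unfolding del spine by simp
  have p0: "permanent ({Spine 0} \<union> ?P0) L = 27 * 4 + 27"
    using at0[of "{Spine 0}"] unfolding spine by (simp add: permanent_empty)
  have q012: "permanent (?S \<union> ?P0 \<union> ?P1) L =
      3 ^ t * (27 * (20 * real t + 49) + real t / 3 * (27 * 20))"
    using at1[of ?S] unfolding del p012 p02 by (simp add: algebra_simps)
  have q01: "permanent ({Spine 0, Spine 1} \<union> ?P0 \<union> ?P1) L =
      3 ^ t * (27 * (5 * real t + 11) + real t / 3 * (27 * 5))"
    using at1[of "{Spine 0, Spine 1}"] unfolding del p01 p0 by (simp add: algebra_simps)
  have "permanent (?S \<union> ?P0 \<union> ?P1 \<union> ?P2) L = 3 ^ (t + 6) * (100 * real t + 180) / 3"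
    using at2[of ?S] unfolding del q012 q01 by (simp add: power_add algebra_simps)
  then show ?thesis
    by (simp only: pverts_T3t3 L_def)
qed

lemma laplacian_ratio_T3t3:
  "laplacian_ratio (pendant_tree [3, t, 3]) =
     (3 / 2) ^ (t + 6) * ((100 * real t + 180) / (48 * (real t + 2)))"
  unfolding laplacian_ratio_def permanent_T3t3 prod_degree_T3t3
  by (simp add: power_divide field_simps)

lemma laplacian_ratio_T3t3_gt:
  assumes "t \<ge> 4"
  shows "laplacian_ratio (pendant_tree [3, t, 3]) > 2 * (3 / 2) ^ (t + 6)"
proof -
  have "2 < (100 * real t + 180) / (48 * (real t + 2))"
    using assms by (simp add: field_simps)
  then have "(3 / 2) ^ (t + 6) * 2 < (3 / 2) ^ (t + 6) * ((100 * real t + 180) / (48 * (real t + 2)))"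
    by (rule mult_strict_left_mono) simp
  then show ?thesis
    unfolding laplacian_ratio_T3t3 by (simp only: mult.commute[of 2])
qed

theorem mainTheorem1:
  shows "(\<forall>t::nat. t \<ge> 4 \<longrightarrow>
           (let T = pendant_tree [3, t, 3]; n = card (pverts T) in
              is_tree T \<and> n = 2 * t + 15 \<and> odd n \<and>
              laplacian_ratio T > 2 * (3 / 2) ^ ((n - 3) div 2)))
       \<and> (\<forall>n::nat. n \<ge> 23 \<and> odd n \<longrightarrow>
           (\<exists>T :: nat pair_pre_digraph. is_tree T \<and> card (pverts T) = n \<and>
              laplacian_ratio T > 2 * (3 / 2) ^ ((n - 3) div 2)))"
proof (intro conjI allI impI)
  fix t :: nat
  assume t: "t \<ge> 4"
  have "is_tree (pendant_tree [3, t, 3])"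
    by (rule is_tree_if_rooted_by[OF rooted_by_pendant_tree]) simp
  then show "let T = pendant_tree [3, t, 3]; n = card (pverts T) in
      is_tree T \<and> n = 2 * t + 15 \<and> odd n \<and>
      laplacian_ratio T > 2 * (3 / 2) ^ ((n - 3) div 2)"
    using laplacian_ratio_T3t3_gt[OF t] by (simp add: Let_def card_T3t3 add.commute)
next
  fix n :: nat
  assume n: "n \<ge> 23 \<and> odd n"
  define t where "t = (n - 15) div 2"
  have t: "t \<ge> 4" "n = 2 * t + 15"
    using n by (auto simp: t_def elim!: oddE)
  obtain T :: "nat pair_pre_digraph" where "is_tree T"
    "card (pverts T) = card (pverts (pendant_tree [3, t, 3]))"
    "laplacian_ratio T = laplacian_ratio (pendant_tree [3, t, 3])"
    using tree_on_nat[OF rooted_by_pendant_tree[of "[3, t, 3]"]] by auto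
  then show "\<exists>T :: nat pair_pre_digraph. is_tree T \<and> card (pverts T) = n \<and>
      laplacian_ratio T > 2 * (3 / 2) ^ ((n - 3) div 2)"
    using laplacian_ratio_T3t3_gt[OF t(1)] t(2)
    by (intro exI[of _ T]) (simp add: card_T3t3 add.commute)
qed

end
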